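(* Starting from $x^0=(1/n)e$, the multiplicative gradient (MG) method finds an $\varepsilon$-optimal solution of the problem $\max_{x\in\Delta_n} f(x)$, with $f(x)=\frac1m\sum_{j=1}^m\ln(a_j^\top x)$, in at most $O\big(mn\ln(n)/\varepsilon\big)$ arithmetic operations.
   Context: Let $m,n\ge 1$, $\Delta_n=\{x\in\mathbb{R}^n: x\ge 0,\ \sum_{i=1}^n x_i=1\}$, $e=(1,\dots,1)^\top\in\mathbb{R}^n$, and let $a_1,\dots,a_m\in\mathbb{R}^n$ be entrywise nonnegative and nonzero; $a_{ji}$ is the $i$-th entry of $a_j$. Let $f(x)=\frac1m\sum_{j=1}^m\ln(a_j^\top x)$ (with $\ln 0=-\infty$) and $f^*=\max_{x\in\Delta_n}f(x)$. For $\varepsilon>0$, an $\varepsilon$-optimal solution is a point $x\in\Delta_n$ with $f^*-f(x)\le\varepsilon$. MG method: from $x^0=(1/n)e$, for $t\ge 0$ set $x_i^{t+1}=x_i^t\,\nabla_i f(x^t)$ for all $i\in\{1,\dots,n\}$, where $\nabla_i f(x)=\frac1m\sum_{j=1}^m\frac{a_{ji}}{a_j^\top x}$. The $O(\cdot)$ hides an absolute constant, independent of $m,n,\varepsilon$ and the data $\{a_j\}$. *)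

theory Defs
  imports "HOL-Analysis.Analysis"
begin

text \<open>
  A vector of length \<open>n\<close> is a function \<^typ>\<open>nat \<Rightarrow> real\<close> read at the indices below \<open>n\<close> (so the
  index set is \<open>{0..<n}\<close> instead of \<open>{1..n}\<close>), and \<open>a j i\<close> is the \<open>i\<close>-th entry of the vector \<open>a j\<close>.
  Points of the simplex and iterates are normalized to be 0 from index \<open>n\<close> on.
\<close>

definition std_simplex :: "nat \<Rightarrow> (nat \<Rightarrow> real) set" where
  "std_simplex n = {x. (\<forall>i<n. 0 \<le> x i) \<and> (\<Sum>i<n. x i) = 1 \<and> (\<forall>i\<ge>n. x i = 0)}"

definition dot_prod :: "nat \<Rightarrow> (nat \<Rightarrow> real) \<Rightarrow> (nat \<Rightarrow> real) \<Rightarrow> real" where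
  "dot_prod n u x = (\<Sum>i<n. u i * x i)"

text \<open>Only used at nonnegative arguments; the library's \<^const>\<open>ln\<close> is real-valued also at 0.\<close>

definition ext_ln :: "real \<Rightarrow> ereal" where
  "ext_ln r = (if r = 0 then -\<infinity> else ereal (ln r))"

definition objective :: "nat \<Rightarrow> nat \<Rightarrow> (nat \<Rightarrow> nat \<Rightarrow> real) \<Rightarrow> (nat \<Rightarrow> real) \<Rightarrow> ereal" where
  "objective m n a x = ereal (1 / real m) * (\<Sum>j<m. ext_ln (dot_prod n (a j) x))"

definition opt_value :: "nat \<Rightarrow> nat \<Rightarrow> (nat \<Rightarrow> nat \<Rightarrow> real) \<Rightarrow> ereal" where
  "opt_value m n a = (GREATEST v. v \<in> objective m n a ` std_simplex n)"

definition eps_optimal ::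
    "nat \<Rightarrow> nat \<Rightarrow> (nat \<Rightarrow> nat \<Rightarrow> real) \<Rightarrow> real \<Rightarrow> (nat \<Rightarrow> real) \<Rightarrow> bool" where
  "eps_optimal m n a \<epsilon> x \<longleftrightarrow>
     x \<in> std_simplex n \<and> opt_value m n a - objective m n a x \<le> ereal \<epsilon>"

definition grad :: "nat \<Rightarrow> nat \<Rightarrow> (nat \<Rightarrow> nat \<Rightarrow> real) \<Rightarrow> (nat \<Rightarrow> real) \<Rightarrow> nat \<Rightarrow> real" where
  "grad m n a x i = 1 / real m * (\<Sum>j<m. a j i / dot_prod n (a j) x)"

primrec mg_iterate :: "nat \<Rightarrow> nat \<Rightarrow> (nat \<Rightarrow> nat \<Rightarrow> real) \<Rightarrow> nat \<Rightarrow> (nat \<Rightarrow> real)" where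
  "mg_iterate m n a 0 = (\<lambda>i. if i < n then 1 / real n else 0)"
| "mg_iterate m n a (Suc t) =
     (\<lambda>i. if i < n then mg_iterate m n a t i * grad m n a (mg_iterate m n a t) i else 0)"


text \<open>
  Cost model: a computation is a pair of its result and the number of arithmetic operations
  performed. Every addition, multiplication and division of reals costs 1; access to stored
  values, copying and index handling are free.
\<close>

type_synonym 'a counted = "'a \<times> nat"

definition ret :: "'a \<Rightarrow> 'a counted" where
  "ret x = (x, 0)"

definition and_then :: "'a counted \<Rightarrow> ('a \<Rightarrow> 'b counted) \<Rightarrow> 'b counted"  (infixl "\<rhd>" 54) where
  "c \<rhd> f = (fst (f (fst c)), snd c + snd (f (fst c)))"

definition add_op :: "real \<Rightarrow> real \<Rightarrow> real counted" where
  "add_op x y = (x + y, 1)"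

definition mult_op :: "real \<Rightarrow> real \<Rightarrow> real counted" where
  "mult_op x y = (x * y, 1)"

definition div_op :: "real \<Rightarrow> real \<Rightarrow> real counted" where
  "div_op x y = (x / y, 1)"

primrec sum_loop :: "nat \<Rightarrow> (nat \<Rightarrow> real counted) \<Rightarrow> real counted" where
  "sum_loop 0 g = ret 0"
| "sum_loop (Suc k) g = sum_loop k g \<rhd> (\<lambda>s. g k \<rhd> (\<lambda>y. add_op s y))"

text \<open>
  Computes and stores the entries below \<open>n\<close> of a vector, each of them once; reading the stored
  vector later is free.
\<close>

definition tabulate :: "nat \<Rightarrow> (nat \<Rightarrow> real counted) \<Rightarrow> (nat \<Rightarrow> real) counted" where
  "tabulate n g = ((\<lambda>i. if i < n then fst (g i) else 0), (\<Sum>i<n. snd (g i)))"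

text \<open>One MG iteration: the \<open>m\<close> inner products are computed once and shared by all \<open>n\<close> coordinates.\<close>

definition mg_step_prog ::
    "nat \<Rightarrow> nat \<Rightarrow> (nat \<Rightarrow> nat \<Rightarrow> real) \<Rightarrow> (nat \<Rightarrow> real) \<Rightarrow> (nat \<Rightarrow> real) counted" where
  "mg_step_prog m n a x =
     tabulate m (\<lambda>j. sum_loop n (\<lambda>i. mult_op (a j i) (x i))) \<rhd> (\<lambda>y.
     tabulate n (\<lambda>i.
       sum_loop m (\<lambda>j. div_op (a j i) (y j)) \<rhd> (\<lambda>s.
       div_op s (real m) \<rhd> (\<lambda>g.
       mult_op (x i) g))))"

text \<open>The starting point is part of the input of the method, so it is available at no cost.\<close>

primrec mg_prog ::
    "nat \<Rightarrow> nat \<Rightarrow> (nat \<Rightarrow> nat \<Rightarrow> real) \<Rightarrow> nat \<Rightarrow> (nat \<Rightarrow> real) counted" where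
  "mg_prog m n a 0 = ret (\<lambda>i. if i < n then 1 / real n else 0)"
| "mg_prog m n a (Suc t) = mg_prog m n a t \<rhd> mg_step_prog m n a"

end

theory Submission
  imports Defs
begin

text \<open>
  An MG step raises \<open>f\<close> by at least the Kullback--Leibler divergence of the new point from the old
  one, so a maximizer \<open>z\<close> of \<open>f\<close> is a fixed point. Hence for every coordinate \<open>i\<close> in its support
  the numbers \<open>a\<^sub>j\<^sub>i / (m a\<^sub>j\<^sup>T z)\<close> are convex weights in \<open>j\<close>. Jensen's inequality with
  these weights gives \<open>f z - f x \<le> \<Sum>\<^sub>i z\<^sub>i ln (\<nabla>\<^sub>i f x)\<close>. Along the iterates the right-hand side is the
  decrease of the divergence of \<open>z\<close> from the iterate, which is at most \<open>ln n\<close> at the start and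
  never negative. Hence the sum of the gaps over the first \<open>T\<close> iterates is at most \<open>ln n\<close>, and one
  of them has gap at most \<open>ln n / T\<close>.
\<close>

section \<open>Inequalities for the logarithm\<close>

text \<open>Sum the tangent bound for \<open>ln\<close> at the mean with the given weights.
  Positivity is asked only where the weight is positive, because \<open>f_mg_step_ge\<close> applies
  this to gradient entries that may vanish elsewhere.\<close>

lemma ln_jensen:
  fixes w y :: "'a \<Rightarrow> real"
  assumes fin: "finite I" and w: "\<And>i. i \<in> I \<Longrightarrow> 0 \<le> w i" "sum w I = 1"
    and y: "\<And>i. i \<in> I \<Longrightarrow> w i > 0 \<Longrightarrow> y i > 0"
  shows "(\<Sum>i\<in>I. w i * ln (y i)) \<le> ln (\<Sum>i\<in>I. w i * y i)"
proof -
  define S where "S = (\<Sum>i\<in>I. w i * y i)"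
  have nonneg: "0 \<le> w i * y i" if "i \<in> I" for i
    using w(1)[OF that] y[OF that] by (cases "w i = 0") auto
  obtain k where k: "k \<in> I" "w k > 0"
    using w by (metis less_eq_real_def sum.neutral zero_neq_one)
  have S: "S > 0"
    unfolding S_def using k y nonneg by (intro sum_pos2[OF fin k(1)]) auto
  have "w i * ln (y i) \<le> w i * ln S + w i * y i / S - w i" if "i \<in> I" for i
  proof (cases "w i = 0")
    case False
    then have wi: "w i > 0" using w(1)[OF that] by simp
    have yi: "y i > 0" using y[OF that wi] .
    have "ln (y i / S) \<le> y i / S - 1"
      using yi S by (intro ln_le_minus_one) simp
    then have "ln (y i) \<le> ln S + y i / S - 1"
      using yi S by (simp add: ln_div)
    from mult_left_mono[OF this, of "w i"] show ?thesis
      using wi by (simp add: algebra_simps)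
  qed simp
  then have "(\<Sum>i\<in>I. w i * ln (y i)) \<le> (\<Sum>i\<in>I. w i * ln S + w i * y i / S - w i)"
    by (rule sum_mono)
  also have "\<dots> = sum w I * ln S + S / S - sum w I"
    unfolding S_def by (simp only: sum.distrib sum_subtractf sum_distrib_right sum_divide_distrib)
  also have "\<dots> = ln S" using S w(2) by simp
  finally show ?thesis unfolding S_def .
qed

lemma mult_ln_ge:
  fixes g :: real
  assumes "g \<ge> 0"
  shows "g - 1 \<le> g * ln g"
proof (cases "g = 0")
  case False
  then have g: "g > 0" using assms by simp
  have "ln (1 / g) \<le> 1 / g - 1" using g by (intro ln_le_minus_one) simp
  then have "1 - 1 / g \<le> ln g" using g by (simp add: ln_div)
  from mult_left_mono[OF this, of g] show ?thesis using g by (simp add: algebra_simps)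
qed simp

text \<open>The equality case of \<open>mult_ln_ge\<close>; it turns a vanishing gain at a maximizer
  into unit gradient entries.\<close>

lemma mult_ln_eqD:
  fixes g :: real
  assumes "g \<ge> 0" "g * ln g = g - 1"
  shows "g = 1"
proof -
  have g: "g > 0" using assms by (cases "g = 0") auto
  then have "ln (1 / g) = 1 / g - 1" using assms(2) by (simp add: ln_div field_simps)
  then have "1 / g = 1" using g by (intro ln_eq_minus_one) auto
  then show ?thesis using g by simp
qed

section \<open>The extended logarithm and compactness of the simplex\<close>

lemma ext_ln_mult:
  assumes "0 \<le> x" "0 \<le> y"
  shows "ext_ln (x * y) = ext_ln x + ext_ln y"
  using assms by (auto simp: ext_ln_def ln_mult)

text \<open>Reduces maximizing the extended-real objective to maximizing a product of inner
  products, which is real-valued and continuous on the whole simplex.\<close>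

lemma sum_ext_ln:
  assumes "\<And>j. j < (m::nat) \<Longrightarrow> 0 \<le> d j"
  shows "(\<Sum>j<m. ext_ln (d j)) = ext_ln (\<Prod>j<m. d j)"
  using assms
proof (induction m)
  case 0
  then show ?case by (simp add: ext_ln_def zero_ereal_def)
next
  case (Suc m)
  have "0 \<le> (\<Prod>j<m. d j)" "0 \<le> d m" using Suc.prems by (auto intro: prod_nonneg)
  then show ?case using Suc by (simp add: ext_ln_mult)
qed

lemma ext_ln_mono:
  assumes "0 \<le> x" "x \<le> y"
  shows "ext_ln x \<le> ext_ln y"
  using assms by (auto simp: ext_ln_def)

text \<open>By Tychonoff the box \<open>PiE UNIV B\<close> is compact in the product topology; the
  simplex is its intersection with a closed hyperplane. The normalization to 0 from index
  \<open>n\<close> on supplies the compact factors \<open>{0}\<close>.\<close>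

lemma compact_std_simplex: "compact (std_simplex n)"
proof -
  define B where "B = (\<lambda>i. if i < n then {0..1::real} else {0})"
  have "compactin (product_topology (\<lambda>i. euclidean) UNIV) (PiE UNIV B)"
    by (subst compactin_PiE) (auto simp: B_def)
  then have "compact (PiE UNIV B)"
    by (simp add: euclidean_product_topology)
  moreover have "closed {x::nat \<Rightarrow> real. (\<Sum>i<n. x i) = 1}"
    by (intro closed_Collect_eq continuous_intros continuous_on_product_coordinates)
  ultimately have "compact (PiE UNIV B \<inter> {x. (\<Sum>i<n. x i) = 1})"
    by (rule compact_Int_closed)
  moreover have "PiE UNIV B \<inter> {x. (\<Sum>i<n. x i) = 1} = std_simplex n"
  proof (intro equalityI subsetI)
    fix x assume "x \<in> PiE UNIV B \<inter> {x. (\<Sum>i<n. x i) = 1}"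
    then have x: "\<And>i. x i \<in> B i" "(\<Sum>i<n. x i) = 1" by auto
    have "0 \<le> x i" if "i < n" for i using x(1)[of i] that by (simp add: B_def)
    moreover have "x i = 0" if "i \<ge> n" for i using x(1)[of i] that by (simp add: B_def)
    ultimately show "x \<in> std_simplex n" using x(2) by (simp add: std_simplex_def)
  next
    fix x assume x: "x \<in> std_simplex n"
    have "x i \<le> 1" if "i < n" for i
      using x that member_le_sum[of i "{..<n}" x] by (auto simp: std_simplex_def)
    then show "x \<in> PiE UNIV B \<inter> {x. (\<Sum>i<n. x i) = 1}"
      using x by (auto simp: std_simplex_def B_def)
  qed
  ultimately show ?thesis by simp
qed

lemma std_simplexD:
  assumes "x \<in> std_simplex n"
  shows "0 \<le> x i" "(\<Sum>i<n. x i) = 1" "x i \<le> 1"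
proof -
  show nonneg: "0 \<le> x i" using assms by (cases "i < n") (auto simp: std_simplex_def)
  show sum: "(\<Sum>i<n. x i) = 1" using assms by (simp add: std_simplex_def)
  show "x i \<le> 1"
  proof (cases "i < n")
    case True
    then show ?thesis
      using assms member_le_sum[of i "{..<n}" x] by (auto simp: std_simplex_def)
  qed (use assms in \<open>auto simp: std_simplex_def\<close>)
qed

text \<open>The update is separated from the iteration because the ascent bound is also applied at a
  maximizer.\<close>

definition mg_step :: "nat \<Rightarrow> nat \<Rightarrow> (nat \<Rightarrow> nat \<Rightarrow> real) \<Rightarrow> (nat \<Rightarrow> real) \<Rightarrow> (nat \<Rightarrow> real)" where
  "mg_step m n a x = (\<lambda>i. if i < n then x i * grad m n a x i else 0)"

section \<open>Gradient identities and invariance of the finite domain\<close>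

locale mg_problem =
  fixes m n :: nat and a :: "nat \<Rightarrow> nat \<Rightarrow> real"
  assumes m_pos: "m > 0" and n_pos: "n > 0"
    and a_nonneg: "\<And>j i. j < m \<Longrightarrow> i < n \<Longrightarrow> 0 \<le> a j i"
    and a_nonzero: "\<And>j. j < m \<Longrightarrow> \<exists>i<n. a j i \<noteq> 0"
begin

abbreviation d :: "(nat \<Rightarrow> real) \<Rightarrow> nat \<Rightarrow> real" where
  "d x j \<equiv> dot_prod n (a j) x"

abbreviation g :: "(nat \<Rightarrow> real) \<Rightarrow> nat \<Rightarrow> real" where
  "g \<equiv> grad m n a"

abbreviation \<Delta> :: "(nat \<Rightarrow> real) set" where
  "\<Delta> \<equiv> std_simplex n"

text \<open>The points of the simplex with finite objective: here the real-valued \<open>f\<close>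
  can replace it, and the gradient divides by positive numbers.\<close>

definition dom :: "(nat \<Rightarrow> real) set" where
  "dom = {x \<in> \<Delta>. \<forall>j<m. d x j > 0}"

definition f :: "(nat \<Rightarrow> real) \<Rightarrow> real" where
  "f x = (\<Sum>j<m. ln (d x j)) / real m"

lemma dot_nonneg: "x \<in> \<Delta> \<Longrightarrow> j < m \<Longrightarrow> 0 \<le> d x j"
  unfolding dot_prod_def using a_nonneg by (intro sum_nonneg mult_nonneg_nonneg) (auto simp: std_simplexD)

lemma grad_nonneg: "x \<in> dom \<Longrightarrow> i < n \<Longrightarrow> 0 \<le> g x i"
  unfolding grad_def using a_nonneg
  by (intro mult_nonneg_nonneg sum_nonneg divide_nonneg_nonneg) (auto simp: dom_def less_imp_le)

lemma grad_pos:
  assumes "x \<in> dom" "i < n" "j < m" "a j i > 0"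
  shows "g x i > 0"
proof -
  have "0 < (\<Sum>j<m. a j i / d x j)"
    using assms a_nonneg by (intro sum_pos2[of _ j]) (auto simp: dom_def less_imp_le)
  then show ?thesis using m_pos by (simp add: grad_def)
qed

text \<open>Exchange of the two sums. The vector \<open>c\<close> is arbitrary: \<open>c = x\<close>
  gives the normalization, and \<open>c i = x i * ln (g x i)\<close> enters the ascent
  bound.\<close>

lemma sum_mult_grad:
  assumes "x \<in> dom"
  shows "(\<Sum>i<n. c i * g x i) = (\<Sum>j<m. d c j / d x j) / real m"
proof -
  have "(\<Sum>i<n. c i * g x i) = (\<Sum>i<n. \<Sum>j<m. c i * a j i / d x j) / real m"
    by (simp add: grad_def sum_distrib_left sum_divide_distrib algebra_simps)
  also have "(\<Sum>i<n. \<Sum>j<m. c i * a j i / d x j) = (\<Sum>j<m. \<Sum>i<n. c i * a j i / d x j)"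
    by (rule sum.swap)
  also have "\<dots> = (\<Sum>j<m. d c j / d x j)"
    by (simp add: dot_prod_def sum_divide_distrib mult.commute)
  finally show ?thesis .
qed

lemma sum_mult_grad_self:
  assumes "x \<in> dom"
  shows "(\<Sum>i<n. x i * g x i) = 1"
proof -
  have "(\<Sum>j<m. d x j / d x j) = (\<Sum>j<m. 1)"
    using assms by (intro sum.cong) (auto simp: dom_def)
  then show ?thesis using sum_mult_grad[OF assms, of x] m_pos by simp
qed

lemma mg_step_dom:
  assumes "x \<in> dom"
  shows "mg_step m n a x \<in> dom"
proof -
  have x: "x \<in> \<Delta>" using assms by (simp add: dom_def)
  have "mg_step m n a x \<in> \<Delta>"
    using std_simplexD(1)[OF x] grad_nonneg[OF assms] sum_mult_grad_self[OF assms]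
    by (simp add: std_simplex_def mg_step_def)
  moreover have "d (mg_step m n a x) j > 0" if j: "j < m" for j
  proof -
    have "(\<Sum>i<n. a j i * x i) > 0" using assms j by (simp add: dom_def dot_prod_def)
    then obtain i where i: "i < n" "a j i * x i > 0"
      using sum_nonpos[of "{..<n}" "\<lambda>i. a j i * x i"] by (fastforce simp: not_le)
    have pos: "a j i > 0" "x i > 0"
      using i a_nonneg[OF j i(1)] std_simplexD(1)[OF x, of i] by (auto simp: zero_less_mult_iff)
    \<comment> \<open>Row \<open>j\<close> itself makes this gradient entry positive, so the mass
      that keeps its inner product positive survives the step.\<close>
    have "g x i > 0" using grad_pos[OF assms i(1) j pos(1)] .
    then have "0 < (\<Sum>i<n. a j i * (x i * g x i))"
      using pos i a_nonneg[OF j] grad_nonneg[OF assms] std_simplexD(1)[OF x]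
      by (intro sum_pos2[of _ i]) auto
    then show ?thesis by (simp add: dot_prod_def mg_step_def)
  qed
  ultimately show ?thesis by (simp add: dom_def)
qed

lemma start_dom: "mg_iterate m n a 0 \<in> dom"
proof -
  have "d (mg_iterate m n a 0) j > 0" if j: "j < m" for j
  proof -
    obtain i where i: "i < n" "a j i \<noteq> 0" using a_nonzero[OF j] by auto
    then have "a j i > 0" using a_nonneg[OF j, of i] by auto
    then have "0 < (\<Sum>i<n. a j i * (1 / real n))"
      using a_nonneg[OF j] i n_pos by (intro sum_pos2[of _ i]) auto
    then show ?thesis by (simp add: dot_prod_def)
  qed
  then show ?thesis using n_pos by (simp add: dom_def std_simplex_def)
qed

lemma iterate_dom: "mg_iterate m n a t \<in> dom"
proof (induction t)
  case 0
  then show ?case using start_dom .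
next
  case (Suc t)
  then show ?case using mg_step_dom by (simp add: mg_step_def)
qed

section \<open>Existence of a maximizer\<close>

lemma objective_eq:
  assumes "x \<in> dom"
  shows "objective m n a x = ereal (f x)"
proof -
  have "(\<Sum>j<m. ext_ln (d x j)) = (\<Sum>j<m. ereal (ln (d x j)))"
    using assms by (intro sum.cong) (auto simp: dom_def ext_ln_def)
  then show ?thesis by (simp add: objective_def f_def)
qed

lemma maximizer_exists:
  obtains z where "z \<in> dom" "\<And>x. x \<in> dom \<Longrightarrow> f x \<le> f z" "opt_value m n a = ereal (f z)"
proof -
  define P where "P x = (\<Prod>j<m. d x j)" for x
  have "continuous_on \<Delta> P"
    unfolding P_def dot_prod_def
    by (intro continuous_intros continuous_on_subset[OF continuous_on_product_coordinates]) auto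
  moreover have "\<Delta> \<noteq> {}" using start_dom by (auto simp: dom_def)
  ultimately obtain z where z: "z \<in> \<Delta>" "\<And>x. x \<in> \<Delta> \<Longrightarrow> P x \<le> P z"
    using continuous_attains_sup[OF compact_std_simplex] by blast
  \<comment> \<open>The starting point has positive product, which forces every inner product at the
    maximizer to be nonzero.\<close>
  have "0 < P (mg_iterate m n a 0)"
    unfolding P_def using start_dom by (intro prod_pos) (auto simp: dom_def)
  then have "P z > 0" using z(2)[of "mg_iterate m n a 0"] start_dom by (auto simp: dom_def)
  then have "d z j \<noteq> 0" if "j < m" for j
    using that prod_zero_iff[of "{..<m}" "d z"] unfolding P_def by fastforce
  then have z_dom: "z \<in> dom" using z(1) dot_nonneg[OF z(1)] by (fastforce simp: dom_def less_le)
  have obj: "objective m n a x = ereal (1 / real m) * ext_ln (P x)" if "x \<in> \<Delta>" for x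
    unfolding objective_def P_def using dot_nonneg[OF that] by (subst sum_ext_ln) auto
  have max: "objective m n a x \<le> objective m n a z" if "x \<in> \<Delta>" for x
  proof -
    have "0 \<le> P x" unfolding P_def using dot_nonneg[OF that] by (intro prod_nonneg) auto
    then show ?thesis
      unfolding obj[OF that] obj[OF z(1)]
      by (intro ereal_mult_left_mono ext_ln_mono z(2)[OF that]) auto
  qed
  have "opt_value m n a = objective m n a z"
    unfolding opt_value_def using z(1) max by (intro Greatest_equality) auto
  moreover have "f x \<le> f z" if "x \<in> dom" for x
    using max[of x] that objective_eq[OF that] objective_eq[OF z_dom] by (simp add: dom_def)
  ultimately show thesis using that z_dom objective_eq[OF z_dom] by metis
qed

section \<open>Ascent of one step and the optimality gap\<close>

text \<open>For each \<open>j\<close>, the ratio of the new to the old inner product is the mean of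
  \<open>g x i\<close> with weights \<open>a j i * x i / d x j\<close>. Jensen bounds its logarithm
  below, and averaging over \<open>j\<close> reassembles the gradient.\<close>

lemma f_mg_step_ge:
  assumes x: "x \<in> dom"
  shows "f x + (\<Sum>i<n. x i * (g x i * ln (g x i))) \<le> f (mg_step m n a x)"
proof -
  have x\<Delta>: "x \<in> \<Delta>" using x by (simp add: dom_def)
  have d: "d x j > 0" "d (mg_step m n a x) j > 0" if "j < m" for j
    using x mg_step_dom[OF x] that by (auto simp: dom_def)
  have *: "(\<Sum>i<n. a j i * x i * ln (g x i)) / d x j \<le> ln (d (mg_step m n a x) j) - ln (d x j)"
    if j: "j < m" for j
  proof -
    have "(\<Sum>i<n. a j i * x i / d x j * ln (g x i)) \<le> ln (\<Sum>i<n. a j i * x i / d x j * g x i)"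
    proof (rule ln_jensen)
      show "0 \<le> a j i * x i / d x j" if "i \<in> {..<n}" for i
        using that a_nonneg[OF j] d(1)[OF j] std_simplexD(1)[OF x\<Delta>] by simp
      show "(\<Sum>i<n. a j i * x i / d x j) = 1"
        using d(1)[OF j] by (simp flip: sum_divide_distrib add: dot_prod_def)
      show "g x i > 0" if "i \<in> {..<n}" "a j i * x i / d x j > 0" for i
      proof -
        have "a j i \<noteq> 0" using that(2) by auto
        then have "a j i > 0" using a_nonneg[OF j, of i] that(1) by auto
        then show ?thesis using grad_pos[OF x _ j] that(1) by auto
      qed
    qed simp
    also have "(\<Sum>i<n. a j i * x i / d x j * g x i) = d (mg_step m n a x) j / d x j"
      unfolding dot_prod_def[of n "a j" "mg_step m n a x"] sum_divide_distrib
      by (simp add: mg_step_def mult.assoc)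
    finally show ?thesis using d[OF j] by (simp add: ln_div sum_divide_distrib)
  qed
  have "(\<Sum>i<n. x i * (g x i * ln (g x i))) = (\<Sum>i<n. (x i * ln (g x i)) * g x i)"
    by (simp add: mult_ac)
  also have "\<dots> = (\<Sum>j<m. (\<Sum>i<n. a j i * x i * ln (g x i)) / d x j) / real m"
    unfolding sum_mult_grad[OF x] by (simp add: dot_prod_def mult.assoc)
  also have "\<dots> \<le> (\<Sum>j<m. ln (d (mg_step m n a x) j) - ln (d x j)) / real m"
    using * by (intro divide_right_mono sum_mono) auto
  also have "\<dots> = f (mg_step m n a x) - f x"
    by (simp add: f_def sum_subtractf diff_divide_distrib)
  finally show ?thesis by simp
qed

lemma grad_maximizer:
  assumes z: "z \<in> dom" "\<And>x. x \<in> dom \<Longrightarrow> f x \<le> f z" and i: "i < n" "z i > 0"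
  shows "g z i = 1"
proof -
  have z\<Delta>: "z \<in> \<Delta>" using z by (simp add: dom_def)
  \<comment> \<open>Subtracting \<open>g z i - 1\<close> makes each term nonnegative and leaves the
    sum unchanged, since \<open>z i * g z i\<close> and \<open>z i\<close> both sum to 1.\<close>
  define h where "h i = z i * (g z i * ln (g z i) - (g z i - 1))" for i
  have h: "0 \<le> h i" if "i < n" for i
    unfolding h_def using std_simplexD(1)[OF z\<Delta>] mult_ln_ge[OF grad_nonneg[OF z(1) that]] by simp
  have "(\<Sum>i<n. h i) = (\<Sum>i<n. z i * (g z i * ln (g z i))) - ((\<Sum>i<n. z i * g z i) - (\<Sum>i<n. z i))"
    by (simp add: h_def right_diff_distrib sum_subtractf)
  also have "\<dots> \<le> 0"
    using f_mg_step_ge[OF z(1)] z(2)[OF mg_step_dom[OF z(1)]]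
      sum_mult_grad_self[OF z(1)] std_simplexD(2)[OF z\<Delta>] by simp
  finally have "(\<Sum>i<n. h i) = 0" using h by (intro antisym sum_nonneg) auto
  then have "h i = 0" using h i(1) by (subst (asm) sum_nonneg_eq_0_iff) auto
  then show ?thesis using i mult_ln_eqD grad_nonneg[OF z(1) i(1)] by (simp add: h_def)
qed

lemma gap_le:
  assumes z: "z \<in> dom" "\<And>x. x \<in> dom \<Longrightarrow> f x \<le> f z" and x: "x \<in> dom"
  shows "f z - f x \<le> (\<Sum>i<n. z i * ln (g x i))"
proof -
  have d: "d x j > 0" "d z j > 0" if "j < m" for j using x z that by (auto simp: dom_def)
  define r where "r j = ln (d z j / d x j)" for j
  have *: "z i * (\<Sum>j<m. a j i / (real m * d z j) * r j) \<le> z i * ln (g x i)" if i: "i < n" for i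
  \<comment> \<open>The weights are known to sum to 1 only on the support of \<open>z\<close>; off
    it both sides vanish.\<close>
  proof (cases "z i = 0")
    case False
    then have zi: "z i > 0" using z std_simplexD(1)[of z n i] by (simp add: dom_def)
    have "(\<Sum>j<m. a j i / (real m * d z j) * r j)
        \<le> ln (\<Sum>j<m. a j i / (real m * d z j) * (d z j / d x j))"
      unfolding r_def
    proof (rule ln_jensen)
      show "0 \<le> a j i / (real m * d z j)" if "j \<in> {..<m}" for j
        using that a_nonneg[OF _ i] d(2)[of j] by simp
      show "(\<Sum>j<m. a j i / (real m * d z j)) = 1"
        using grad_maximizer[OF z i zi] by (simp add: grad_def sum_distrib_left)
    qed (use d in auto)
    also have "(\<Sum>j<m. a j i / (real m * d z j) * (d z j / d x j)) = g x i"
      unfolding grad_def sum_distrib_left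
    proof (rule sum.cong)
      show "a j i / (real m * d z j) * (d z j / d x j) = 1 / real m * (a j i / d x j)"
        if "j \<in> {..<m}" for j
        using d(2)[of j] that by simp
    qed simp
    finally show ?thesis using zi by simp
  qed simp
  have "f z - f x = (\<Sum>j<m. ln (d z j) - ln (d x j)) / real m"
    by (simp add: f_def sum_subtractf diff_divide_distrib)
  \<comment> \<open>Writing \<open>1 / real m\<close> as \<open>d z j / (real m * d z j)\<close> and
    expanding the numerator distributes each log-ratio over the coordinates.\<close>
  also have "\<dots> = (\<Sum>j<m. (\<Sum>i<n. a j i * z i) / (real m * d z j) * r j)"
    unfolding sum_divide_distrib
  proof (rule sum.cong)
    show "(ln (d z j) - ln (d x j)) / real m = (\<Sum>i<n. a j i * z i / (real m * d z j)) * r j"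
      if "j \<in> {..<m}" for j
    proof -
      have "(\<Sum>i<n. a j i * z i / (real m * d z j)) = d z j / (real m * d z j)"
        by (simp add: dot_prod_def flip: sum_divide_distrib)
      then show ?thesis using d[of j] that by (simp add: r_def ln_div)
    qed
  qed simp
  also have "\<dots> = (\<Sum>j<m. \<Sum>i<n. z i * (a j i / (real m * d z j) * r j))"
    unfolding sum_divide_distrib sum_distrib_right by (simp add: mult_ac)
  also have "\<dots> = (\<Sum>i<n. z i * (\<Sum>j<m. a j i / (real m * d z j) * r j))"
    by (subst sum.swap) (simp add: sum_distrib_left)
  also have "\<dots> \<le> (\<Sum>i<n. z i * ln (g x i))"
    using * by (intro sum_mono) auto
  finally show ?thesis .
qed

section \<open>Summing the gaps along the iterates\<close>

text \<open>Since \<open>g z i = 1\<close>, column \<open>i\<close> of the data is not zero. Hence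
  this gradient entry is positive throughout \<open>dom\<close>, and the coordinate never dies
  out.\<close>

lemma iterate_pos:
  assumes z: "z \<in> dom" "\<And>x. x \<in> dom \<Longrightarrow> f x \<le> f z" and i: "i < n" "z i > 0"
  shows "mg_iterate m n a t i > 0" "g (mg_iterate m n a t) i > 0"
proof -
  have "\<exists>j<m. a j i \<noteq> 0"
  proof (rule ccontr)
    assume "\<not> (\<exists>j<m. a j i \<noteq> 0)"
    then have "g z i = 0" by (simp add: grad_def)
    then show False using grad_maximizer[OF z i] by simp
  qed
  then obtain j where j: "j < m" "a j i > 0" using a_nonneg i(1) less_le by metis
  show *: "g (mg_iterate m n a t) i > 0" for t
    using grad_pos[OF iterate_dom i(1) j] .
  show "mg_iterate m n a t i > 0"
    using * i(1) by (induction t) auto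
qed

lemma sum_gaps_le:
  assumes z: "z \<in> dom" "\<And>x. x \<in> dom \<Longrightarrow> f x \<le> f z"
  shows "(\<Sum>t<T. f z - f (mg_iterate m n a t)) \<le> ln (real n)"
proof -
  let ?x = "mg_iterate m n a"
  have z\<Delta>: "z \<in> \<Delta>" using z by (simp add: dom_def)
  have "(\<Sum>t<T. f z - f (?x t)) \<le> (\<Sum>t<T. \<Sum>i<n. z i * ln (g (?x t) i))"
    using gap_le[OF z iterate_dom] by (intro sum_mono) auto
  also have "\<dots> = (\<Sum>i<n. z i * (\<Sum>t<T. ln (g (?x t) i)))"
    by (subst sum.swap) (simp add: sum_distrib_left)
  also have "\<dots> \<le> (\<Sum>i<n. z i * ln (real n))"
  proof (rule sum_mono)
    fix i assume "i \<in> {..<n}"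
    then have i: "i < n" by simp
    show "z i * (\<Sum>t<T. ln (g (?x t) i)) \<le> z i * ln (real n)"
    proof (cases "z i = 0")
      case False
      then have zi: "z i > 0" using std_simplexD(1)[OF z\<Delta>, of i] by simp
      note pos = iterate_pos[OF z i zi]
      \<comment> \<open>Telescoping: each gradient entry is the ratio of consecutive iterates, and
        the start contributes \<open>1 / real n\<close>.\<close>
      have "(\<Sum>t<T. ln (g (?x t) i)) = ln (?x T i) + ln (real n)"
      proof (induction T)
        case 0
        then show ?case using i n_pos by (simp add: ln_div)
      next
        case (Suc T)
        then show ?case using i pos[of T] by (simp add: ln_mult)
      qed
      moreover have "?x T i \<le> 1" using iterate_dom[of T] by (auto simp: dom_def std_simplexD)
      then have "ln (?x T i) \<le> 0" using pos(1)[of T] by simp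
      ultimately show ?thesis using zi by simp
    qed simp
  qed
  also have "\<dots> = ln (real n)"
    using std_simplexD(2)[OF z\<Delta>] by (simp flip: sum_distrib_right)
  finally show ?thesis .
qed

lemma eps_optimal_iterate:
  assumes "\<epsilon> > 0"
  obtains t where "real t \<le> ln (real n) / \<epsilon>" "eps_optimal m n a \<epsilon> (mg_iterate m n a t)"
proof -
  obtain z where z: "z \<in> dom" "\<And>x. x \<in> dom \<Longrightarrow> f x \<le> f z" "opt_value m n a = ereal (f z)"
    using maximizer_exists by blast
  let ?x = "mg_iterate m n a"
  \<comment> \<open>Iterates 0 to \<open>k\<close> number more than
    \<open>ln (real n) / \<epsilon>\<close>, so not all gaps exceed \<epsilon>. Rounding down avoids
    an additive 1, which matters for \<open>n = 1\<close>, where the cost bound is 0.\<close>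
  define k where "k = nat \<lfloor>ln (real n) / \<epsilon>\<rfloor>"
  have "ln (real n) / \<epsilon> \<ge> 0" using assms n_pos by simp
  then have k: "real k \<le> ln (real n) / \<epsilon>" "ln (real n) / \<epsilon> < real (Suc k)"
    unfolding k_def by linarith+
  have "\<exists>t<Suc k. f z - f (?x t) \<le> \<epsilon>"
  proof (rule ccontr)
    assume "\<not> (\<exists>t<Suc k. f z - f (?x t) \<le> \<epsilon>)"
    then have "(\<Sum>t<Suc k. \<epsilon>) \<le> (\<Sum>t<Suc k. f z - f (?x t))"
      by (intro sum_mono) (simp add: not_le less_imp_le)
    also have "\<dots> \<le> ln (real n)" using sum_gaps_le[OF z(1,2)] .
    finally show False using k(2) assms by (simp add: pos_divide_less_eq)
  qed
  then obtain t where t: "t < Suc k" "f z - f (?x t) \<le> \<epsilon>" by blast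
  have "eps_optimal m n a \<epsilon> (?x t)"
    using t(2) iterate_dom[of t] objective_eq[OF iterate_dom[of t]] z(3)
    by (simp add: eps_optimal_def dom_def)
  then show thesis using that t(1) k(1) by (metis less_Suc_eq_le of_nat_mono order_trans)
qed

end

section \<open>Operation count\<close>

lemma sum_loop_eq: "sum_loop k h = (\<Sum>i<k. fst (h i), \<Sum>i<k. snd (h i) + 1)"
  by (induction k) (simp_all add: ret_def and_then_def add_op_def)

text \<open>The inner products and the gradient sums cost \<open>2 * m * n\<close> each, counting
  the addition to the initial 0; every coordinate then needs one division and one
  multiplication.\<close>

lemma mg_step_prog_eq:
  "mg_step_prog m n a x = (mg_step m n a x, 4 * m * n + 2 * n)"
  by (auto simp: mg_step_prog_def mg_step_def tabulate_def and_then_def sum_loop_eq mult_op_def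
      div_op_def grad_def dot_prod_def algebra_simps)

lemma mg_prog_eq: "mg_prog m n a t = (mg_iterate m n a t, t * (4 * m * n + 2 * n))"
  by (induction t) (simp_all add: ret_def and_then_def mg_step_prog_eq mg_step_def)

theorem proposition4:
  shows "\<exists>C::real. C > 0 \<and>
    (\<forall>(m::nat) (n::nat) (a :: nat \<Rightarrow> nat \<Rightarrow> real) (\<epsilon>::real).
      m \<ge> 1 \<longrightarrow> n \<ge> 1 \<longrightarrow>
      (\<forall>j<m. (\<forall>i<n. 0 \<le> a j i) \<and> (\<exists>i<n. a j i \<noteq> 0)) \<longrightarrow>
      \<epsilon> > 0 \<longrightarrow>
      (\<exists>t N. mg_prog m n a t = (mg_iterate m n a t, N) \<and>
             eps_optimal m n a \<epsilon> (mg_iterate m n a t) \<and>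
             real N \<le> C * (real m * real n * ln (real n) / \<epsilon>)))"
proof (rule exI[of _ 6], intro conjI allI impI)
  fix m n :: nat and a :: "nat \<Rightarrow> nat \<Rightarrow> real" and \<epsilon> :: real
  assume mn: "m \<ge> 1" "n \<ge> 1"
    and a: "\<forall>j<m. (\<forall>i<n. 0 \<le> a j i) \<and> (\<exists>i<n. a j i \<noteq> 0)" and \<epsilon>: "\<epsilon> > 0"
  interpret mg_problem m n a
    using mn a by unfold_locales auto
  obtain t where t: "real t \<le> ln (real n) / \<epsilon>" "eps_optimal m n a \<epsilon> (mg_iterate m n a t)"
    using eps_optimal_iterate[OF \<epsilon>] .
  \<comment> \<open>The constant 6 arises by absorbing \<open>2 * n\<close> into
    \<open>2 * m * n\<close>, as \<open>m \<ge> 1\<close>.\<close>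
  have "4 * m * n + 2 * n \<le> 6 * (m * n)" using mn by simp
  then have "t * (4 * m * n + 2 * n) \<le> t * (6 * (m * n))" by (rule mult_le_mono2)
  then have "real (t * (4 * m * n + 2 * n)) \<le> real (t * (6 * (m * n)))" by (rule of_nat_mono)
  also have "\<dots> = 6 * (real m * real n) * real t" by simp
  also have "\<dots> \<le> 6 * (real m * real n) * (ln (real n) / \<epsilon>)"
    using t(1) by (intro mult_left_mono) auto
  finally show "\<exists>t N. mg_prog m n a t = (mg_iterate m n a t, N) \<and>
      eps_optimal m n a \<epsilon> (mg_iterate m n a t) \<and>
      real N \<le> 6 * (real m * real n * ln (real n) / \<epsilon>)"
    using t(2) mg_prog_eq by (auto simp: mult_ac)
qed simp

end
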